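(* Let $T\in\mathbb{Z}_{+}$ and $b\in\mathcal{B}$, and consider the nonlinear program (NLP) defined in the context. Let $(\mu,\delta)$ be a feasible solution of the NLP. Then $\mu$ is the vector of moments of the probability distribution $\mathbb{P}_\delta$ induced by $\delta$, i.e. $\mu_s^t=\mathbb{P}_\delta(S_t=s)$ for all $s\in\mathcal{S}$, $t\in\{0,\dots,T+1\}$; $\mu_{soa}^t=\mathbb{P}_\delta(S_t=s,O_t=o,A_t=a)$ and $\mu_{sa}^t=\mathbb{P}_\delta(S_t=s,A_t=a)$ for all $s\in\mathcal{S},o\in\mathcal{O},a\in\mathcal{A}$, $t\in\{0,\dots,T\}$. Moreover $(\mu,\delta)$ is an optimal solution of the NLP if and only if $\delta$ is an optimal policy of the memoryless POMDP problem (as defined in the context). In particular, $w_{\mathrm{ml}}^T(b)=z_{\mathrm{ml}}^T(b)$, where $z_{\mathrm{ml}}^T(b)$ is the optimal value of the NLP.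
   Context: **POMDP.** $\mathcal{S},\mathcal{O},\mathcal{A}$ are finite nonempty sets (states, observations, actions); $p(o|s)$ is a probability distribution on $\mathcal{O}$ for each $s$; $p(s'|s,a)$ is a probability distribution on $\mathcal{S}$ for each $(s,a)$; $r_t:\mathcal{S}\times\mathcal{A}\to\mathbb{R}$, $t\in\{0,\dots,T\}$, are arbitrary reward functions. $\mathcal{B}$ is the set of probability distributions on $\mathcal{S}$; $b\in\mathcal{B}$ is the initial belief. Write $[T]=\{0,1,\dots,T\}$. **Memoryless policies.** $\Delta_{\mathrm{ml}}^T$ is the set of $\delta=(\delta^t_{a|o})_{t\in[T],a\in\mathcal{A},o\in\mathcal{O}}$ with $\delta^t_{a|o}\ge 0$ and $\sum_a\delta^t_{a|o}=1$ for all $o,t$. The distribution $\mathbb{P}_\delta$ on trajectories $(S_t,O_t,A_t)_{0\le t\le T},S_{T+1}$ assigns to $(s_t,o_t,a_t)_{0\le t\le T},s_{T+1}$ the probability $b(s_0)\prod_{t=0}^T p(o_t|s_t)\,\delta^t_{a_t|o_t}\,p(s_{t+1}|s_t,a_t)$; $\mathbb{E}_\delta[\cdot\,|\,S_0\sim b]$ is its expectation. $\mathbb{E}_\delta[\cdot\,|\,S_0\sim b,A_0=a]$ denotes the expectation when the initial action is forced to be $a$ (i.e. $\delta^0_{a|o}$ is replaced by $1$, and $\delta^0_{a'|o}$ by $0$ for $a'\ne a$, for every $o$). **Memoryless POMDP problem.** $$w_{\mathrm{ml}}^T(b)=\max_{a\in\mathcal{A},\,\delta\in\Delta_{\mathrm{ml}}^T}\mathbb{E}_\delta\Big[\sum_{t=0}^T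 r_t(S_t,A_t)\,\Big|\,S_0\sim b,A_0=a\Big].$$ The initial action is thus chosen independently of the initial observation. A policy $\delta\in\Delta_{\mathrm{ml}}^T$ is called an optimal policy of this problem if $\delta^0_{a|o}=\delta^0_{a|o'}$ for all $o,o',a$ and $\mathbb{E}_\delta[\sum_{t=0}^T r_t(S_t,A_t)\,|\,S_0\sim b]=w_{\mathrm{ml}}^T(b)$. **NLP.** Variables $\mu=\big((\mu_s^t)_{t\in[T+1]},(\mu_{soa}^t)_{t\in[T]},(\mu_{sa}^t)_{t\in[T]}\big)$ indexed by $s\in\mathcal{S},o\in\mathcal{O},a\in\mathcal{A}$, and $\delta=(\delta^t_{a|o})_{t\in[T]}$. Maximize $\sum_{t=0}^T\sum_{s,a}r_t(s,a)\mu_{sa}^t$ subject to: - $\delta^0_{a|o}=\delta^0_{a|o'}$ for all $o,o',a$; - $\mu_s^0=b(s)$ for all $s$; - $\mu_s^t=\sum_a\mu_{sa}^t$ for all $s$, $t\in[T]$; - $\mu_{sa}^t=\sum_o\mu_{soa}^t$ for all $s,a$, $t\in[T]$; - $\mu_s^{t+1}=\sum_{s',a'}p(s|s',a')\mu_{s'a'}^t$ for all $s$, $t\in[T]$; - $\mu_{soa}^t=\delta^t_{a|o}\,p(o|s)\,\mu_s^t$ for all $s,o,a$, $t\in[T]$; - $\delta\in\Delta_{\mathrm{ml}}^T$, $\mu\ge 0$. *)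

theory Defs
  imports "HOL-Probability.Probability"
begin

record ('s, 'o, 'a) pomdp =
  obs_prob :: "'s \<Rightarrow> 'o pmf"
  trans_prob :: "'s \<Rightarrow> 'a \<Rightarrow> 's pmf"
  reward :: "nat \<Rightarrow> 's \<Rightarrow> 'a \<Rightarrow> real"

text \<open>
  The value \<open>\<delta> t ob a\<close> is the probability of taking action \<open>a\<close> at time \<open>t\<close> given observation \<open>ob\<close>.
  Values at times \<open>t > T\<close> are junk: they are not constrained here, nor used anywhere below.
\<close>

type_synonym ('o, 'a) policy = "nat \<Rightarrow> 'o \<Rightarrow> 'a \<Rightarrow> real"

definition memoryless_policies :: "nat \<Rightarrow> ('o::finite, 'a::finite) policy set" where
  "memoryless_policies T =
     {\<delta>. \<forall>t\<le>T. \<forall>ob. (\<forall>a. 0 \<le> \<delta> t ob a) \<and> (\<Sum>a\<in>UNIV. \<delta> t ob a) = 1}"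

text \<open>
  A trajectory consists of the states at times \<open>0, \<dots>, T + 1\<close> and of the observations and the actions
  at times \<open>0, \<dots>, T\<close>. The functions are extensional, so there are only finitely many trajectories.
\<close>

type_synonym ('s, 'o, 'a) trajectory = "(nat \<Rightarrow> 's) \<times> (nat \<Rightarrow> 'o) \<times> (nat \<Rightarrow> 'a)"

definition state_at :: "nat \<Rightarrow> ('s, 'o, 'a) trajectory \<Rightarrow> 's" where
  "state_at t \<tau> = fst \<tau> t"

definition obs_at :: "nat \<Rightarrow> ('s, 'o, 'a) trajectory \<Rightarrow> 'o" where
  "obs_at t \<tau> = fst (snd \<tau>) t"

definition act_at :: "nat \<Rightarrow> ('s, 'o, 'a) trajectory \<Rightarrow> 'a" where
  "act_at t \<tau> = snd (snd \<tau>) t"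

definition trajectories :: "nat \<Rightarrow> ('s, 'o, 'a) trajectory set" where
  "trajectories T = ({..Suc T} \<rightarrow>\<^sub>E UNIV) \<times> ({..T} \<rightarrow>\<^sub>E UNIV) \<times> ({..T} \<rightarrow>\<^sub>E UNIV)"

definition trajectory_prob ::
  "('s, 'o, 'a) pomdp \<Rightarrow> nat \<Rightarrow> 's pmf \<Rightarrow> ('o, 'a) policy \<Rightarrow> ('s, 'o, 'a) trajectory \<Rightarrow> real" where
  "trajectory_prob M T b \<delta> \<tau> =
     pmf b (state_at 0 \<tau>) *
     (\<Prod>t\<le>T. pmf (obs_prob M (state_at t \<tau>)) (obs_at t \<tau>) *
        \<delta> t (obs_at t \<tau>) (act_at t \<tau>) *
        pmf (trans_prob M (state_at t \<tau>) (act_at t \<tau>)) (state_at (Suc t) \<tau>))"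

definition trajectory_measure ::
  "('s, 'o, 'a) pomdp \<Rightarrow> nat \<Rightarrow> 's pmf \<Rightarrow> ('o, 'a) policy \<Rightarrow> ('s, 'o, 'a) trajectory measure" where
  "trajectory_measure M T b \<delta> =
     point_measure (trajectories T) (\<lambda>\<tau>. ennreal (trajectory_prob M T b \<delta> \<tau>))"

definition expected_reward ::
  "('s, 'o, 'a) pomdp \<Rightarrow> nat \<Rightarrow> 's pmf \<Rightarrow> ('o, 'a) policy \<Rightarrow> real" where
  "expected_reward M T b \<delta> =
     (LINT \<tau>|trajectory_measure M T b \<delta>. (\<Sum>t\<le>T. reward M t (state_at t \<tau>) (act_at t \<tau>)))"

definition force_initial_action :: "'a \<Rightarrow> ('o, 'a) policy \<Rightarrow> ('o, 'a) policy" where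
  "force_initial_action a \<delta> = \<delta>(0 := (\<lambda>ob a'. if a' = a then 1 else 0))"

definition memoryless_feasible ::
  "nat \<Rightarrow> 'a::finite \<times> ('o::finite, 'a) policy \<Rightarrow> bool" where
  "memoryless_feasible T = (\<lambda>(a, \<delta>). \<delta> \<in> memoryless_policies T)"

definition memoryless_objective ::
  "('s::finite, 'o::finite, 'a::finite) pomdp \<Rightarrow> nat \<Rightarrow> 's pmf \<Rightarrow> 'a \<times> ('o, 'a) policy \<Rightarrow> real" where
  "memoryless_objective M T b = (\<lambda>(a, \<delta>). expected_reward M T b (force_initial_action a \<delta>))"

text \<open>
  Both optimal values are defined as suprema. A real supremum is only the maximum when the latter
  exists, so attainment has to be stated separately wherever the values are used as maxima.
\<close>

definition w_ml :: "('s::finite, 'o::finite, 'a::finite) pomdp \<Rightarrow> nat \<Rightarrow> 's pmf \<Rightarrow> real" where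
  "w_ml M T b = (SUP x\<in>{x. memoryless_feasible T x}. memoryless_objective M T b x)"

definition initially_blind :: "('o, 'a) policy \<Rightarrow> bool" where
  "initially_blind \<delta> \<longleftrightarrow> (\<forall>ob ob' a. \<delta> 0 ob a = \<delta> 0 ob' a)"

definition optimal_memoryless_policy ::
  "('s::finite, 'o::finite, 'a::finite) pomdp \<Rightarrow> nat \<Rightarrow> 's pmf \<Rightarrow> ('o, 'a) policy \<Rightarrow> bool" where
  "optimal_memoryless_policy M T b \<delta> \<longleftrightarrow>
     \<delta> \<in> memoryless_policies T \<and> initially_blind \<delta> \<and> expected_reward M T b \<delta> = w_ml M T b"

record ('s, 'o, 'a) moments =
  mu_s :: "nat \<Rightarrow> 's \<Rightarrow> real"
  mu_soa :: "nat \<Rightarrow> 's \<Rightarrow> 'o \<Rightarrow> 'a \<Rightarrow> real"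
  mu_sa :: "nat \<Rightarrow> 's \<Rightarrow> 'a \<Rightarrow> real"

definition nlp_feasible ::
  "('s::finite, 'o::finite, 'a::finite) pomdp \<Rightarrow> nat \<Rightarrow> 's pmf \<Rightarrow>
     ('s, 'o, 'a) moments \<times> ('o, 'a) policy \<Rightarrow> bool" where
  "nlp_feasible M T b = (\<lambda>(\<mu>, \<delta>).
     initially_blind \<delta> \<and>
     (\<forall>s. mu_s \<mu> 0 s = pmf b s) \<and>
     (\<forall>t\<le>T. \<forall>s. mu_s \<mu> t s = (\<Sum>a\<in>UNIV. mu_sa \<mu> t s a)) \<and>
     (\<forall>t\<le>T. \<forall>s a. mu_sa \<mu> t s a = (\<Sum>ob\<in>UNIV. mu_soa \<mu> t s ob a)) \<and>
     (\<forall>t\<le>T. \<forall>s. mu_s \<mu> (Suc t) s =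
        (\<Sum>s'\<in>UNIV. \<Sum>a'\<in>UNIV. pmf (trans_prob M s' a') s * mu_sa \<mu> t s' a')) \<and>
     (\<forall>t\<le>T. \<forall>s ob a. mu_soa \<mu> t s ob a = \<delta> t ob a * pmf (obs_prob M s) ob * mu_s \<mu> t s) \<and>
     \<delta> \<in> memoryless_policies T \<and>
     (\<forall>t\<le>Suc T. \<forall>s. 0 \<le> mu_s \<mu> t s) \<and>
     (\<forall>t\<le>T. \<forall>s ob a. 0 \<le> mu_soa \<mu> t s ob a) \<and>
     (\<forall>t\<le>T. \<forall>s a. 0 \<le> mu_sa \<mu> t s a))"

definition nlp_objective ::
  "('s::finite, 'o, 'a::finite) pomdp \<Rightarrow> nat \<Rightarrow> ('s, 'o, 'a) moments \<times> ('o, 'a) policy \<Rightarrow> real" where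
  "nlp_objective M T = (\<lambda>(\<mu>, \<delta>).
     \<Sum>t\<le>T. \<Sum>s\<in>UNIV. \<Sum>a\<in>UNIV. reward M t s a * mu_sa \<mu> t s a)"

definition z_ml :: "('s::finite, 'o::finite, 'a::finite) pomdp \<Rightarrow> nat \<Rightarrow> 's pmf \<Rightarrow> real" where
  "z_ml M T b = (SUP x\<in>{x. nlp_feasible M T b x}. nlp_objective M T x)"

end

theory Submission
  imports Defs
begin

text \<open>
  The constraints of the nonlinear program are the forward equations of the controlled chain. Fix a
  policy \<open>\<delta>\<close>. The initial condition fixes \<open>\<mu>\<close> on the states at time \<open>0\<close>; the product constraint
  turns it into the joint moments of state, observation and action, their sum over the observations
  gives the moments of state and action, and the transition constraint passes to the states at the next
  time. So \<open>\<mu>\<close> is a function of \<open>\<delta>\<close> alone. The marginals of \<open>\<P>\<^sub>\<delta>\<close> satisfy the same recursion,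
  because summing the probability of a trajectory over its last observation, action and state leaves the
  probability of the shorter trajectory. Hence they are the moments
  (\<open>nlp_feasible_mu_s\<close>, \<open>prob_state\<close>), every policy whose initial action ignores the observation
  (a blind policy, for short) extends to a feasible pair (\<open>nlp_feasible_moments_of\<close>), and by linearity
  of expectation the objective of a feasible pair is the expected reward of its policy
  (\<open>nlp_objective_feasible\<close>). The program therefore maximises the expected reward over all blind
  policies.

  The memoryless problem only compares policies with a deterministic initial action, a subset of the
  blind policies. Nothing is lost: if \<open>\<delta>\<close> is blind, its reward is the average, with weights
  \<open>\<delta>\<^sup>0\<close>, of the rewards of the policies that force each initial action, so one of these is at least as
  good (\<open>exists_forced_action_at_least\<close>).

  Both problems attain their supremum because a best blind policy exists: the expected reward is a
  polynomial in finitely many entries of the policy, and Tychonoff's theorem makes the set of blind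
  policies compact (\<open>exists_best_blind_policy\<close>). That policy, paired with its moments or with a best
  initial action, solves either problem with the same value, and the optimal solutions of both are the
  policies that reach this value.
\<close>

section \<open>Trajectories with a given number of steps\<close>

text \<open>
  Counting steps instead of using the horizon \<open>T\<close> allows an induction that starts at the path without
  any step, which consists of an initial state only. The horizon \<open>T\<close> corresponds to \<open>Suc T\<close> steps.
\<close>

definition paths :: "nat \<Rightarrow> ('s, 'o, 'a) trajectory set" where
  "paths n = ({..n} \<rightarrow>\<^sub>E UNIV) \<times> ({..<n} \<rightarrow>\<^sub>E UNIV) \<times> ({..<n} \<rightarrow>\<^sub>E UNIV)"

definition step_prob ::
  "('s, 'o, 'a) pomdp \<Rightarrow> ('o, 'a) policy \<Rightarrow> nat \<Rightarrow> 's \<Rightarrow> 'o \<Rightarrow> 'a \<Rightarrow> 's \<Rightarrow> real" where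
  "step_prob M \<delta> t s ob a s' =
     pmf (obs_prob M s) ob * \<delta> t ob a * pmf (trans_prob M s a) s'"

definition path_prob ::
  "('s, 'o, 'a) pomdp \<Rightarrow> nat \<Rightarrow> 's pmf \<Rightarrow> ('o, 'a) policy \<Rightarrow> ('s, 'o, 'a) trajectory \<Rightarrow> real" where
  "path_prob M n b \<delta> \<tau> = pmf b (state_at 0 \<tau>) *
     (\<Prod>t<n. step_prob M \<delta> t (state_at t \<tau>) (obs_at t \<tau>) (act_at t \<tau>) (state_at (Suc t) \<tau>))"

definition path_expectation ::
  "('s, 'o, 'a) pomdp \<Rightarrow> nat \<Rightarrow> 's pmf \<Rightarrow> ('o, 'a) policy \<Rightarrow>
     (('s, 'o, 'a) trajectory \<Rightarrow> real) \<Rightarrow> real" where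
  "path_expectation M n b \<delta> f = (\<Sum>\<tau>\<in>paths n. path_prob M n b \<delta> \<tau> * f \<tau>)"

definition append_step ::
  "nat \<Rightarrow> 'o \<Rightarrow> 'a \<Rightarrow> 's \<Rightarrow> ('s, 'o, 'a) trajectory \<Rightarrow> ('s, 'o, 'a) trajectory" where
  "append_step n ob a s' = (\<lambda>(x, y, z). (x(Suc n := s'), y(n := ob), z(n := a)))"

lemma append_step_simps [simp]:
  "state_at t (append_step n ob a s' \<tau>) = (if t = Suc n then s' else state_at t \<tau>)"
  "obs_at t (append_step n ob a s' \<tau>) = (if t = n then ob else obs_at t \<tau>)"
  "act_at t (append_step n ob a s' \<tau>) = (if t = n then a else act_at t \<tau>)"
  by (auto simp: append_step_def state_at_def obs_at_def act_at_def split: prod.splits)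

lemma trajectories_eq_paths: "trajectories T = paths (Suc T)"
  by (simp add: trajectories_def paths_def lessThan_Suc_atMost)

lemma trajectory_prob_eq_path_prob: "trajectory_prob M T b = path_prob M (Suc T) b"
  by (intro ext) (simp add: trajectory_prob_def path_prob_def step_prob_def lessThan_Suc_atMost)

lemma finite_paths [simp]:
  "finite (paths n :: ('s::finite, 'o::finite, 'a::finite) trajectory set)"
  by (simp add: paths_def finite_PiE)

text \<open>
  The observation and action components of a path without steps are the extensional functions on the
  empty domain, so such a path is determined by its initial state.
\<close>

lemma path_expectation_0:
  fixes M :: "('s::finite, 'o::finite, 'a::finite) pomdp"
  assumes "\<And>\<tau>. f \<tau> = g (state_at 0 \<tau>)"
  shows "path_expectation M 0 b \<delta> f = (\<Sum>s\<in>UNIV. pmf b s * g s)"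
  unfolding path_expectation_def
  by (rule sum.reindex_bij_witness[where
        i = "\<lambda>s. ((\<lambda>t. undefined)(0 := s), (\<lambda>t. undefined), (\<lambda>t. undefined))" and j = "state_at 0"])
     (auto simp: paths_def path_prob_def state_at_def PiE_def extensional_def fun_eq_iff assms)

text \<open>Cutting off the last step is inverse to appending one, because paths are extensional.\<close>

lemma sum_paths_Suc:
  fixes F :: "('s::finite, 'o::finite, 'a::finite) trajectory \<Rightarrow> real"
  shows "(\<Sum>\<tau>\<in>paths (Suc n). F \<tau>) =
    (\<Sum>\<tau>\<in>paths n. \<Sum>ob\<in>UNIV. \<Sum>a\<in>UNIV. \<Sum>s'\<in>UNIV. F (append_step n ob a s' \<tau>))"
proof -
  have "(\<Sum>\<tau>\<in>paths (Suc n). F \<tau>) =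
      (\<Sum>(\<tau>, ob, a, s')\<in>paths n \<times> UNIV \<times> UNIV \<times> UNIV. F (append_step n ob a s' \<tau>))"
    by (rule sum.reindex_bij_witness[where
          i = "\<lambda>(\<tau>, ob, a, s'). append_step n ob a s' \<tau>" and
          j = "\<lambda>\<tau>. ((restrict (fst \<tau>) {..n}, restrict (fst (snd \<tau>)) {..<n},
             restrict (snd (snd \<tau>)) {..<n}), obs_at n \<tau>, act_at n \<tau>, state_at (Suc n) \<tau>)"])
       (auto simp: paths_def append_step_def state_at_def obs_at_def act_at_def
          PiE_def extensional_def restrict_def intro!: arg_cong[of _ _ F] ext)
  then show ?thesis
    by (simp add: sum.cartesian_product)
qed

lemma path_prob_append_step:
  "path_prob M (Suc n) b \<delta> (append_step n ob a s' \<tau>) =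
     path_prob M n b \<delta> \<tau> * step_prob M \<delta> n (state_at n \<tau>) ob a s'"
  by (simp add: path_prob_def)

lemma path_expectation_Suc:
  fixes M :: "('s::finite, 'o::finite, 'a::finite) pomdp"
  shows "path_expectation M (Suc n) b \<delta> f =
    path_expectation M n b \<delta> (\<lambda>\<tau>. \<Sum>ob\<in>UNIV. \<Sum>a\<in>UNIV. \<Sum>s'\<in>UNIV.
      step_prob M \<delta> n (state_at n \<tau>) ob a s' * f (append_step n ob a s' \<tau>))"
  by (simp add: path_expectation_def sum_paths_Suc path_prob_append_step sum_distrib_left mult.assoc)

lemma sum_pmf_UNIV [simp]: "(\<Sum>x\<in>UNIV. pmf p x) = 1" for p :: "'x::finite pmf"
  by (simp add: sum_pmf_eq_1)

lemma sum_step_prob_next: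
  fixes M :: "('s::finite, 'o::finite, 'a::finite) pomdp"
  shows "(\<Sum>s'\<in>UNIV. step_prob M \<delta> t s ob a s') = pmf (obs_prob M s) ob * \<delta> t ob a"
  by (simp add: step_prob_def flip: sum_distrib_left)

lemma sum_step_prob:
  fixes M :: "('s::finite, 'o::finite, 'a::finite) pomdp"
  assumes "\<delta> \<in> memoryless_policies T" "t \<le> T"
  shows "(\<Sum>ob\<in>UNIV. \<Sum>a\<in>UNIV. \<Sum>s'\<in>UNIV. step_prob M \<delta> t s ob a s') = 1"
  using assms by (simp add: sum_step_prob_next memoryless_policies_def flip: sum_distrib_left)

text \<open>
  Consistency of the path distributions: a quantity that ignores the steps from time \<open>n\<close> on can be
  averaged over the paths with \<open>n\<close> steps, since the weights of each later step sum to one.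
\<close>

lemma path_expectation_drop_future:
  fixes M :: "('s::finite, 'o::finite, 'a::finite) pomdp"
  assumes \<delta>: "\<delta> \<in> memoryless_policies T"
    and "n \<le> N" "N \<le> Suc T"
    and f: "\<And>m ob a s' \<tau>. n \<le> m \<Longrightarrow> f (append_step m ob a s' \<tau>) = f \<tau>"
  shows "path_expectation M N b \<delta> f = path_expectation M n b \<delta> f"
  using assms(2,3)
proof (induction N rule: dec_induct)
  case (step m)
  have "path_expectation M (Suc m) b \<delta> f =
      path_expectation M m b \<delta> (\<lambda>\<tau>. (\<Sum>ob\<in>UNIV. \<Sum>a\<in>UNIV. \<Sum>s'\<in>UNIV.
        step_prob M \<delta> m (state_at m \<tau>) ob a s') * f \<tau>)"
    using step.hyps by (simp add: path_expectation_Suc f sum_distrib_right)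
  also have "\<dots> = path_expectation M m b \<delta> f"
    using step.prems by (simp add: sum_step_prob[OF \<delta>])
  finally show ?case
    using step by simp
qed simp

section \<open>Marginals\<close>

text \<open>The forward (Chapman--Kolmogorov) recursion for the distribution of the state.\<close>

primrec state_dist ::
  "('s::finite, 'o::finite, 'a::finite) pomdp \<Rightarrow> 's pmf \<Rightarrow> ('o, 'a) policy \<Rightarrow> nat \<Rightarrow> 's \<Rightarrow> real" where
  "state_dist M b \<delta> 0 = pmf b"
| "state_dist M b \<delta> (Suc t) = (\<lambda>s'. \<Sum>s\<in>UNIV. \<Sum>ob\<in>UNIV. \<Sum>a\<in>UNIV.
     state_dist M b \<delta> t s * step_prob M \<delta> t s ob a s')"

lemma path_expectation_last_state:
  fixes M :: "('s::finite, 'o::finite, 'a::finite) pomdp"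
  shows "path_expectation M n b \<delta> (\<lambda>\<tau>. f (state_at n \<tau>)) =
    (\<Sum>s\<in>UNIV. state_dist M b \<delta> n s * f s)"
proof (induction n arbitrary: f)
  case 0
  show ?case
    by (simp add: path_expectation_0)
next
  case (Suc n)
  have "path_expectation M (Suc n) b \<delta> (\<lambda>\<tau>. f (state_at (Suc n) \<tau>)) =
      (\<Sum>s\<in>UNIV. state_dist M b \<delta> n s *
        (\<Sum>ob\<in>UNIV. \<Sum>a\<in>UNIV. \<Sum>s'\<in>UNIV. step_prob M \<delta> n s ob a s' * f s'))"
    by (simp add: path_expectation_Suc Suc.IH[symmetric])
  also have "\<dots> = (\<Sum>s\<in>UNIV. \<Sum>ob\<in>UNIV. \<Sum>a\<in>UNIV. \<Sum>s'\<in>UNIV.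
      state_dist M b \<delta> n s * step_prob M \<delta> n s ob a s' * f s')"
    by (simp add: sum_distrib_left mult.assoc)
  also have "\<dots> = (\<Sum>s\<in>UNIV. \<Sum>ob\<in>UNIV. \<Sum>s'\<in>UNIV. \<Sum>a\<in>UNIV.
      state_dist M b \<delta> n s * step_prob M \<delta> n s ob a s' * f s')"
    by (intro sum.cong refl sum.swap)
  also have "\<dots> = (\<Sum>s\<in>UNIV. \<Sum>s'\<in>UNIV. \<Sum>ob\<in>UNIV. \<Sum>a\<in>UNIV.
      state_dist M b \<delta> n s * step_prob M \<delta> n s ob a s' * f s')"
    by (intro sum.cong refl sum.swap)
  also have "\<dots> = (\<Sum>s'\<in>UNIV. \<Sum>s\<in>UNIV. \<Sum>ob\<in>UNIV. \<Sum>a\<in>UNIV.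
      state_dist M b \<delta> n s * step_prob M \<delta> n s ob a s' * f s')"
    by (rule sum.swap)
  also have "\<dots> = (\<Sum>s'\<in>UNIV. state_dist M b \<delta> (Suc n) s' * f s')"
    by (simp add: sum_distrib_right)
  finally show ?case .
qed

lemma path_expectation_state:
  fixes M :: "('s::finite, 'o::finite, 'a::finite) pomdp"
  assumes "\<delta> \<in> memoryless_policies T" "t \<le> N" "N \<le> Suc T"
  shows "path_expectation M N b \<delta> (\<lambda>\<tau>. f (state_at t \<tau>)) =
    (\<Sum>s\<in>UNIV. state_dist M b \<delta> t s * f s)"
  by (subst path_expectation_drop_future[OF assms]) (auto simp: path_expectation_last_state)

text \<open>
  Consistency makes \<open>t\<close> the last time at which a step is taken; then only the successor state of
  this step has to be summed out.
\<close>

lemma path_expectation_state_obs_act: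
  fixes M :: "('s::finite, 'o::finite, 'a::finite) pomdp"
  assumes "\<delta> \<in> memoryless_policies T" "t < N" "N \<le> Suc T"
  shows "path_expectation M N b \<delta> (\<lambda>\<tau>. f (state_at t \<tau>) (obs_at t \<tau>) (act_at t \<tau>)) =
    (\<Sum>s\<in>UNIV. \<Sum>ob\<in>UNIV. \<Sum>a\<in>UNIV.
      state_dist M b \<delta> t s * (pmf (obs_prob M s) ob * \<delta> t ob a) * f s ob a)"
proof -
  have "path_expectation M N b \<delta> (\<lambda>\<tau>. f (state_at t \<tau>) (obs_at t \<tau>) (act_at t \<tau>)) =
      path_expectation M (Suc t) b \<delta> (\<lambda>\<tau>. f (state_at t \<tau>) (obs_at t \<tau>) (act_at t \<tau>))"
    using assms by (intro path_expectation_drop_future) auto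
  also have "\<dots> = path_expectation M t b \<delta> (\<lambda>\<tau>. \<Sum>ob\<in>UNIV. \<Sum>a\<in>UNIV.
      pmf (obs_prob M (state_at t \<tau>)) ob * \<delta> t ob a * f (state_at t \<tau>) ob a)"
    by (simp add: path_expectation_Suc sum_step_prob_next flip: sum_distrib_right)
  also have "\<dots> = (\<Sum>s\<in>UNIV. state_dist M b \<delta> t s * (\<Sum>ob\<in>UNIV. \<Sum>a\<in>UNIV.
      pmf (obs_prob M s) ob * \<delta> t ob a * f s ob a))"
    by (rule path_expectation_last_state)
  finally show ?thesis
    by (simp add: sum_distrib_left mult.assoc)
qed

section \<open>The trajectory measure\<close>

lemma path_prob_nonneg:
  assumes "\<delta> \<in> memoryless_policies T" "N \<le> Suc T"
  shows "0 \<le> path_prob M N b \<delta> \<tau>"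
  using assms
  by (auto simp: path_prob_def step_prob_def memoryless_policies_def intro!: mult_nonneg_nonneg prod_nonneg)

lemma prob_trajectory_measure:
  fixes M :: "('s::finite, 'o::finite, 'a::finite) pomdp"
  assumes "\<delta> \<in> memoryless_policies T"
  shows "\<P>(\<tau> in trajectory_measure M T b \<delta>. P \<tau>) =
    path_expectation M (Suc T) b \<delta> (\<lambda>\<tau>. of_bool (P \<tau>))"
proof -
  have "\<P>(\<tau> in trajectory_measure M T b \<delta>. P \<tau>) =
      enn2real (\<Sum>\<tau>\<in>{\<tau>\<in>paths (Suc T). P \<tau>}. ennreal (path_prob M (Suc T) b \<delta> \<tau>))"
    by (simp add: trajectory_measure_def trajectories_eq_paths trajectory_prob_eq_path_prob
        space_point_measure emeasure_point_measure_finite Sigma_Algebra.measure_def)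
  also have "\<dots> = (\<Sum>\<tau>\<in>{\<tau>\<in>paths (Suc T). P \<tau>}. path_prob M (Suc T) b \<delta> \<tau>)"
    by (simp add: path_prob_nonneg[OF assms order_refl] sum_nonneg)
  also have "\<dots> = path_expectation M (Suc T) b \<delta> (\<lambda>\<tau>. of_bool (P \<tau>))"
    unfolding path_expectation_def by (rule sum.mono_neutral_cong_left) auto
  finally show ?thesis .
qed

lemma expected_reward_eq_path_expectation:
  fixes M :: "('s::finite, 'o::finite, 'a::finite) pomdp"
  assumes "\<delta> \<in> memoryless_policies T"
  shows "expected_reward M T b \<delta> =
    path_expectation M (Suc T) b \<delta> (\<lambda>\<tau>. \<Sum>t\<le>T. reward M t (state_at t \<tau>) (act_at t \<tau>))"
  by (simp add: path_prob_nonneg[OF assms order_refl] expected_reward_def trajectory_measure_def trajectories_eq_paths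
      trajectory_prob_eq_path_prob point_measure_def lebesgue_integral_count_space_finite
      integral_density AE_count_space path_expectation_def)

lemma prob_state:
  fixes M :: "('s::finite, 'o::finite, 'a::finite) pomdp"
  assumes "\<delta> \<in> memoryless_policies T" "t \<le> Suc T"
  shows "\<P>(\<tau> in trajectory_measure M T b \<delta>. state_at t \<tau> = s) = state_dist M b \<delta> t s"
  by (simp add: prob_trajectory_measure[OF assms(1)] of_bool_def
      path_expectation_state[OF assms order_refl, of M b "\<lambda>x. if x = s then 1 else 0"]
      if_distrib[of "times _"] cong: if_cong)

lemma prob_state_obs_act:
  fixes M :: "('s::finite, 'o::finite, 'a::finite) pomdp"
  assumes "\<delta> \<in> memoryless_policies T" "t \<le> T"
  shows "\<P>(\<tau> in trajectory_measure M T b \<delta>.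
      state_at t \<tau> = s \<and> obs_at t \<tau> = ob \<and> act_at t \<tau> = a) =
    \<delta> t ob a * pmf (obs_prob M s) ob * state_dist M b \<delta> t s"
proof -
  have "\<P>(\<tau> in trajectory_measure M T b \<delta>.
      state_at t \<tau> = s \<and> obs_at t \<tau> = ob \<and> act_at t \<tau> = a) =
      (\<Sum>s'\<in>UNIV. \<Sum>ob'\<in>UNIV. \<Sum>a'\<in>UNIV.
        state_dist M b \<delta> t s' * (pmf (obs_prob M s') ob' * \<delta> t ob' a') *
        of_bool (s' = s \<and> ob' = ob \<and> a' = a))"
    unfolding prob_trajectory_measure[OF assms(1)]
    using assms by (intro path_expectation_state_obs_act) auto
  \<comment> \<open>One indicator per sum, so that each sum collapses to a single term.\<close>
  also have "\<dots> = (\<Sum>s'\<in>UNIV. (\<Sum>ob'\<in>UNIV. (\<Sum>a'\<in>UNIV.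
        (state_dist M b \<delta> t s' * (pmf (obs_prob M s') ob' * \<delta> t ob' a')) *
        of_bool (a' = a)) * of_bool (ob' = ob)) * of_bool (s' = s))"
    unfolding of_bool_conj sum_distrib_right by (simp only: mult_ac)
  also have "\<dots> = \<delta> t ob a * pmf (obs_prob M s) ob * state_dist M b \<delta> t s"
    by simp
  finally show ?thesis .
qed

lemma prob_state_act:
  fixes M :: "('s::finite, 'o::finite, 'a::finite) pomdp"
  assumes "\<delta> \<in> memoryless_policies T" "t \<le> T"
  shows "\<P>(\<tau> in trajectory_measure M T b \<delta>. state_at t \<tau> = s \<and> act_at t \<tau> = a) =
    (\<Sum>ob\<in>UNIV. \<delta> t ob a * pmf (obs_prob M s) ob * state_dist M b \<delta> t s)"
proof -
  have split_obs: "of_bool (state_at t \<tau> = s \<and> act_at t \<tau> = a) =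
      (\<Sum>ob\<in>UNIV. of_bool (state_at t \<tau> = s \<and> obs_at t \<tau> = ob \<and> act_at t \<tau> = a) :: real)"
    for \<tau> :: "('s, 'o, 'a) trajectory"
    by (cases "state_at t \<tau> = s \<and> act_at t \<tau> = a") auto
  have "\<P>(\<tau> in trajectory_measure M T b \<delta>. state_at t \<tau> = s \<and> act_at t \<tau> = a) =
      (\<Sum>ob\<in>UNIV. \<P>(\<tau> in trajectory_measure M T b \<delta>.
        state_at t \<tau> = s \<and> obs_at t \<tau> = ob \<and> act_at t \<tau> = a))"
    unfolding prob_trajectory_measure[OF assms(1)] path_expectation_def split_obs sum_distrib_left
    by (rule sum.swap)
  then show ?thesis
    by (simp add: prob_state_obs_act[OF assms])
qed

lemma expected_reward_eq_sum_state_dist: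
  fixes M :: "('s::finite, 'o::finite, 'a::finite) pomdp"
  assumes "\<delta> \<in> memoryless_policies T"
  shows "expected_reward M T b \<delta> = (\<Sum>t\<le>T. \<Sum>s\<in>UNIV. \<Sum>a\<in>UNIV. reward M t s a *
    (\<Sum>ob\<in>UNIV. \<delta> t ob a * pmf (obs_prob M s) ob * state_dist M b \<delta> t s))"
proof -
  have "expected_reward M T b \<delta> =
      (\<Sum>t\<le>T. path_expectation M (Suc T) b \<delta> (\<lambda>\<tau>. reward M t (state_at t \<tau>) (act_at t \<tau>)))"
    unfolding expected_reward_eq_path_expectation[OF assms] path_expectation_def sum_distrib_left
    by (rule sum.swap)
  also have "\<dots> = (\<Sum>t\<le>T. \<Sum>s\<in>UNIV. \<Sum>ob\<in>UNIV. \<Sum>a\<in>UNIV.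
      state_dist M b \<delta> t s * (pmf (obs_prob M s) ob * \<delta> t ob a) * reward M t s a)"
    using assms
    by (intro sum.cong refl path_expectation_state_obs_act[where f = "\<lambda>s ob a. reward M _ s a"]) auto
  also have "\<dots> = (\<Sum>t\<le>T. \<Sum>s\<in>UNIV. \<Sum>a\<in>UNIV. \<Sum>ob\<in>UNIV.
      state_dist M b \<delta> t s * (pmf (obs_prob M s) ob * \<delta> t ob a) * reward M t s a)"
    by (intro sum.cong refl sum.swap)
  finally show ?thesis
    by (simp add: sum_distrib_left mult_ac)
qed

section \<open>Feasible solutions of the nonlinear program\<close>

text \<open>
  The constraints are used as rewrite rules one at a time: as a whole they rewrite the state moments at a
  time into state-action moments at the same time and back.
\<close>

lemma nlp_feasibleD:
  fixes M :: "('s::finite, 'o::finite, 'a::finite) pomdp"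
  assumes "nlp_feasible M T b (\<mu>, \<delta>)"
  shows "\<delta> \<in> memoryless_policies T"
    and "initially_blind \<delta>"
    and "mu_s \<mu> 0 s = pmf b s"
    and "t \<le> T \<Longrightarrow> mu_sa \<mu> t s a = (\<Sum>ob\<in>UNIV. mu_soa \<mu> t s ob a)"
    and "t \<le> T \<Longrightarrow> mu_s \<mu> (Suc t) s =
      (\<Sum>s'\<in>UNIV. \<Sum>a'\<in>UNIV. pmf (trans_prob M s' a') s * mu_sa \<mu> t s' a')"
    and "t \<le> T \<Longrightarrow> mu_soa \<mu> t s ob a = \<delta> t ob a * pmf (obs_prob M s) ob * mu_s \<mu> t s"
proof -
  note conditions = assms[unfolded nlp_feasible_def prod.case]
  show "\<delta> \<in> memoryless_policies T"
    using conditions by (elim conjE)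
  show "initially_blind \<delta>"
    using conditions by (elim conjE)
  have "\<forall>s. mu_s \<mu> 0 s = pmf b s"
    using conditions by (elim conjE)
  then show "mu_s \<mu> 0 s = pmf b s" ..
  have "\<forall>t\<le>T. \<forall>s a. mu_sa \<mu> t s a = (\<Sum>ob\<in>UNIV. mu_soa \<mu> t s ob a)"
    using conditions by (elim conjE)
  then show "t \<le> T \<Longrightarrow> mu_sa \<mu> t s a = (\<Sum>ob\<in>UNIV. mu_soa \<mu> t s ob a)"
    by iprover
  have "\<forall>t\<le>T. \<forall>s. mu_s \<mu> (Suc t) s =
      (\<Sum>s'\<in>UNIV. \<Sum>a'\<in>UNIV. pmf (trans_prob M s' a') s * mu_sa \<mu> t s' a')"
    using conditions by (elim conjE)
  then show "t \<le> T \<Longrightarrow> mu_s \<mu> (Suc t) s =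
      (\<Sum>s'\<in>UNIV. \<Sum>a'\<in>UNIV. pmf (trans_prob M s' a') s * mu_sa \<mu> t s' a')"
    by iprover
  have "\<forall>t\<le>T. \<forall>s ob a. mu_soa \<mu> t s ob a = \<delta> t ob a * pmf (obs_prob M s) ob * mu_s \<mu> t s"
    using conditions by (elim conjE)
  then show "t \<le> T \<Longrightarrow> mu_soa \<mu> t s ob a = \<delta> t ob a * pmf (obs_prob M s) ob * mu_s \<mu> t s"
    by iprover
qed

text \<open>
  Together the constraints express the state moments at the next time by those at the current one, and
  this is the recursion of \<^const>\<open>state_dist\<close>.
\<close>

lemma nlp_feasible_mu_s:
  fixes M :: "('s::finite, 'o::finite, 'a::finite) pomdp"
  assumes "nlp_feasible M T b (\<mu>, \<delta>)" "t \<le> Suc T"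
  shows "mu_s \<mu> t = state_dist M b \<delta> t"
  using assms(2)
proof (induction t)
  case 0
  show ?case
    by (intro ext) (simp add: nlp_feasibleD(3)[OF assms(1)])
next
  case (Suc t)
  have "mu_s \<mu> (Suc t) s' = state_dist M b \<delta> (Suc t) s'" for s'
  proof -
    have "mu_s \<mu> (Suc t) s' = (\<Sum>s\<in>UNIV. \<Sum>a\<in>UNIV. pmf (trans_prob M s a) s' *
        (\<Sum>ob\<in>UNIV. \<delta> t ob a * pmf (obs_prob M s) ob * state_dist M b \<delta> t s))"
      using Suc by (simp add: nlp_feasibleD(4-6)[OF assms(1)])
    also have "\<dots> = (\<Sum>s\<in>UNIV. \<Sum>a\<in>UNIV. \<Sum>ob\<in>UNIV.
        state_dist M b \<delta> t s * step_prob M \<delta> t s ob a s')"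
      by (simp add: sum_distrib_left step_prob_def mult_ac)
    also have "\<dots> = state_dist M b \<delta> (Suc t) s'"
      unfolding state_dist.simps by (intro sum.cong refl sum.swap)
    finally show ?thesis .
  qed
  then show ?case by blast
qed

lemma nlp_feasible_mu_soa:
  fixes M :: "('s::finite, 'o::finite, 'a::finite) pomdp"
  assumes "nlp_feasible M T b (\<mu>, \<delta>)" "t \<le> T"
  shows "mu_soa \<mu> t s ob a = \<delta> t ob a * pmf (obs_prob M s) ob * state_dist M b \<delta> t s"
  by (simp add: nlp_feasibleD(6)[OF assms] nlp_feasible_mu_s[OF assms(1)] assms(2) le_SucI)

lemma nlp_feasible_mu_sa:
  fixes M :: "('s::finite, 'o::finite, 'a::finite) pomdp"
  assumes "nlp_feasible M T b (\<mu>, \<delta>)" "t \<le> T"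
  shows "mu_sa \<mu> t s a = (\<Sum>ob\<in>UNIV. \<delta> t ob a * pmf (obs_prob M s) ob * state_dist M b \<delta> t s)"
  by (simp add: nlp_feasibleD(4)[OF assms] nlp_feasible_mu_soa[OF assms])

lemma nlp_objective_feasible:
  fixes M :: "('s::finite, 'o::finite, 'a::finite) pomdp"
  assumes "nlp_feasible M T b (\<mu>, \<delta>)"
  shows "nlp_objective M T (\<mu>, \<delta>) = expected_reward M T b \<delta>"
  by (simp add: nlp_objective_def nlp_feasible_mu_sa[OF assms]
      expected_reward_eq_sum_state_dist[OF nlp_feasibleD(1)[OF assms]])

definition moments_of ::
  "('s::finite, 'o::finite, 'a::finite) pomdp \<Rightarrow> 's pmf \<Rightarrow> ('o, 'a) policy \<Rightarrow> ('s, 'o, 'a) moments" where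
  "moments_of M b \<delta> = \<lparr>
     mu_s = state_dist M b \<delta>,
     mu_soa = (\<lambda>t s ob a. \<delta> t ob a * pmf (obs_prob M s) ob * state_dist M b \<delta> t s),
     mu_sa = (\<lambda>t s a. \<Sum>ob\<in>UNIV. \<delta> t ob a * pmf (obs_prob M s) ob * state_dist M b \<delta> t s)\<rparr>"

lemma state_dist_nonneg:
  fixes M :: "('s::finite, 'o::finite, 'a::finite) pomdp"
  assumes "\<delta> \<in> memoryless_policies T" "t \<le> Suc T"
  shows "0 \<le> state_dist M b \<delta> t s"
  unfolding prob_state[OF assms, symmetric] by (rule measure_nonneg)

text \<open>
  The constraint \<open>\<mu>\<^sub>s = \<Sum>\<^sub>a \<mu>\<^sub>s\<^sub>a\<close> holds because actions and observations are drawn with total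
  probability one; the evolution constraint is the forward recursion.
\<close>

lemma nlp_feasible_moments_of:
  fixes M :: "('s::finite, 'o::finite, 'a::finite) pomdp"
  assumes "\<delta> \<in> memoryless_policies T" "initially_blind \<delta>"
  shows "nlp_feasible M T b (moments_of M b \<delta>, \<delta>)"
proof -
  have total: "state_dist M b \<delta> t s =
      (\<Sum>a\<in>UNIV. \<Sum>ob\<in>UNIV. \<delta> t ob a * pmf (obs_prob M s) ob * state_dist M b \<delta> t s)"
    if "t \<le> T" for t s
  proof -
    have "(\<Sum>a\<in>UNIV. \<Sum>ob\<in>UNIV. \<delta> t ob a * pmf (obs_prob M s) ob * state_dist M b \<delta> t s) =
        (\<Sum>ob\<in>UNIV. \<Sum>a\<in>UNIV. \<delta> t ob a * (pmf (obs_prob M s) ob * state_dist M b \<delta> t s))"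
      by (subst sum.swap) (simp add: mult.assoc)
    also have "\<dots> = state_dist M b \<delta> t s"
      using assms that by (simp add: memoryless_policies_def flip: sum_distrib_right)
    finally show ?thesis ..
  qed
  have evolve: "state_dist M b \<delta> (Suc t) s' =
      (\<Sum>s\<in>UNIV. \<Sum>a\<in>UNIV. pmf (trans_prob M s a) s' *
        (\<Sum>ob\<in>UNIV. \<delta> t ob a * pmf (obs_prob M s) ob * state_dist M b \<delta> t s))" for t s'
  proof -
    have "state_dist M b \<delta> (Suc t) s' = (\<Sum>s\<in>UNIV. \<Sum>a\<in>UNIV. \<Sum>ob\<in>UNIV.
        state_dist M b \<delta> t s * step_prob M \<delta> t s ob a s')"
      unfolding state_dist.simps by (intro sum.cong refl sum.swap)
    then show ?thesis
      by (simp add: sum_distrib_left step_prob_def mult_ac)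
  qed
  have nonneg: "0 \<le> \<delta> t ob a * pmf (obs_prob M s) ob * state_dist M b \<delta> t s"
    if "t \<le> T" for t s ob a
    using assms(1) that
    by (intro mult_nonneg_nonneg state_dist_nonneg[OF assms(1)] pmf_nonneg)
       (auto simp: memoryless_policies_def)
  show ?thesis
    unfolding nlp_feasible_def prod.case moments_of_def moments.simps
    using assms total evolve nonneg state_dist_nonneg[OF assms(1)]
    by (auto intro!: sum_nonneg)
qed

section \<open>Forcing the initial action\<close>

lemma force_initial_action_policy:
  "\<delta> \<in> memoryless_policies T \<Longrightarrow> force_initial_action a \<delta> \<in> memoryless_policies T"
  by (simp add: memoryless_policies_def force_initial_action_def)

lemma initially_blind_force: "initially_blind (force_initial_action a \<delta>)"
  by (simp add: initially_blind_def force_initial_action_def)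

text \<open>
  The initial row of the policy enters the probability of a path in exactly one factor, so this
  probability is linear in that row. The row is the same for every observation, whence the weights
  can be read off at an arbitrary \<open>ob\<close> and do not depend on the path.
\<close>

lemma path_prob_mixture:
  fixes \<delta> :: "('o::finite, 'a::finite) policy"
  assumes "initially_blind \<delta>"
  shows "path_prob M (Suc n) b \<delta> \<tau> =
    (\<Sum>a\<in>UNIV. \<delta> 0 ob a * path_prob M (Suc n) b (force_initial_action a \<delta>) \<tau>)"
proof -
  have blind: "\<delta> 0 (obs_at 0 \<tau>) a = \<delta> 0 ob a" for a
    using assms by (auto simp: initially_blind_def)
  \<comment> \<open>The factors that do not involve the initial row of the policy.\<close>
  define c where "c = pmf b (state_at 0 \<tau>) * pmf (obs_prob M (state_at 0 \<tau>)) (obs_at 0 \<tau>) *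
    pmf (trans_prob M (state_at 0 \<tau>) (act_at 0 \<tau>)) (state_at (Suc 0) \<tau>) *
    (\<Prod>t<n. step_prob M \<delta> (Suc t) (state_at (Suc t) \<tau>) (obs_at (Suc t) \<tau>)
       (act_at (Suc t) \<tau>) (state_at (Suc (Suc t)) \<tau>))"
  have "(\<Sum>a\<in>UNIV. \<delta> 0 ob a * path_prob M (Suc n) b (force_initial_action a \<delta>) \<tau>) =
      (\<Sum>a\<in>UNIV. if act_at 0 \<tau> = a then \<delta> 0 ob a * c else 0)"
    unfolding path_prob_def prod.lessThan_Suc_shift c_def
    by (intro sum.cong refl) (simp add: step_prob_def force_initial_action_def)
  also have "\<dots> = path_prob M (Suc n) b \<delta> \<tau>"
    unfolding path_prob_def prod.lessThan_Suc_shift c_def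
    by (simp add: step_prob_def blind)
  finally show ?thesis ..
qed

lemma expected_reward_mixture:
  fixes M :: "('s::finite, 'o::finite, 'a::finite) pomdp"
  assumes "\<delta> \<in> memoryless_policies T" "initially_blind \<delta>"
  shows "expected_reward M T b \<delta> =
    (\<Sum>a\<in>UNIV. \<delta> 0 ob a * expected_reward M T b (force_initial_action a \<delta>))"
proof -
  have "expected_reward M T b \<delta> = (\<Sum>\<tau>\<in>paths (Suc T). \<Sum>a\<in>UNIV.
      \<delta> 0 ob a * (path_prob M (Suc T) b (force_initial_action a \<delta>) \<tau> *
        (\<Sum>t\<le>T. reward M t (state_at t \<tau>) (act_at t \<tau>))))"
    unfolding expected_reward_eq_path_expectation[OF assms(1)] path_expectation_def
      path_prob_mixture[OF assms(2), where ob = ob]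
    by (simp only: sum_distrib_right mult.assoc)
  also have "\<dots> = (\<Sum>a\<in>UNIV. \<delta> 0 ob a * expected_reward M T b (force_initial_action a \<delta>))"
    by (subst sum.swap)
       (simp only: expected_reward_eq_path_expectation[OF force_initial_action_policy[OF assms(1)]]
          path_expectation_def sum_distrib_left)
  finally show ?thesis .
qed

text \<open>A weighted average cannot exceed all of the values that it averages.\<close>

lemma exists_forced_action_at_least:
  fixes M :: "('s::finite, 'o::finite, 'a::finite) pomdp"
  assumes "\<delta> \<in> memoryless_policies T" "initially_blind \<delta>"
  shows "\<exists>a. expected_reward M T b \<delta> \<le> expected_reward M T b (force_initial_action a \<delta>)"
proof (rule ccontr)
  define V where "V = expected_reward M T b \<delta>"
  fix ob :: 'o
  assume "\<not> ?thesis"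
  then have less: "expected_reward M T b (force_initial_action a \<delta>) < V" for a
    by (auto simp: V_def not_le)
  have weights: "\<And>a. 0 \<le> \<delta> 0 ob a" "(\<Sum>a\<in>UNIV. \<delta> 0 ob a) = 1"
    using assms(1) by (auto simp: memoryless_policies_def)
  then obtain a where "\<delta> 0 ob a > 0"
    by (metis less_eq_real_def sum.neutral zero_neq_one)
  then have "(\<Sum>a\<in>UNIV. \<delta> 0 ob a * expected_reward M T b (force_initial_action a \<delta>)) <
      (\<Sum>a\<in>UNIV. \<delta> 0 ob a * V)"
    by (intro sum_strict_mono_ex1 ballI mult_left_mono bexI[of _ a] mult_strict_left_mono
        weights less less_imp_le) auto
  also have "\<dots> = V"
    by (simp only: sum_distrib_right[symmetric] weights(2) mult_1_left)
  finally show False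
    by (simp only: V_def expected_reward_mixture[OF assms, of M b ob, symmetric] less_irrefl)
qed

section \<open>Existence of a maximiser\<close>

text \<open>
  Freezing a policy from time \<open>T\<close> on replaces its arbitrary entries after the horizon by probabilities
  and leaves the expected reward unchanged.
\<close>

definition stationary_after :: "nat \<Rightarrow> ('o, 'a) policy \<Rightarrow> ('o, 'a) policy" where
  "stationary_after T \<delta> = (\<lambda>t. \<delta> (min t T))"

text \<open>
  The rows are required to be probability vectors at all times, not only up to a horizon: otherwise the
  entries at later times would be unbounded and the set would not be compact.
\<close>

definition blind_policies :: "('o::finite, 'a::finite) policy set" where
  "blind_policies = {\<delta>. initially_blind \<delta> \<and>
     (\<forall>t ob. (\<forall>a. 0 \<le> \<delta> t ob a) \<and> (\<Sum>a\<in>UNIV. \<delta> t ob a) = 1)}"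

lemma expected_reward_cong:
  fixes M :: "('s::finite, 'o::finite, 'a::finite) pomdp"
  assumes "\<And>t. t \<le> T \<Longrightarrow> \<delta> t = \<delta>' t"
  shows "expected_reward M T b \<delta> = expected_reward M T b \<delta>'"
proof -
  have "trajectory_prob M T b \<delta> = trajectory_prob M T b \<delta>'"
    unfolding trajectory_prob_def using assms by (intro ext arg_cong2[of _ _ _ _ times] prod.cong) auto
  then show ?thesis
    by (simp add: expected_reward_def trajectory_measure_def)
qed

lemma continuous_on_policy_entry: "continuous_on S (\<lambda>\<delta>::('o, 'a) policy. \<delta> t ob a)"
proof -
  have "continuous_on S (\<lambda>\<delta>::('o, 'a) policy. \<delta> t)"
    by (rule continuous_on_product_then_coordinatewise[where f = "\<lambda>\<delta>. \<delta>"]) (rule continuous_on_id)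
  then have "continuous_on S (\<lambda>\<delta>::('o, 'a) policy. \<delta> t ob)"
    by (rule continuous_on_product_then_coordinatewise[where f = "\<lambda>\<delta>. \<delta> t"])
  then show ?thesis
    by (rule continuous_on_product_then_coordinatewise[where f = "\<lambda>\<delta>. \<delta> t ob"])
qed

lemma closed_blind_policies: "closed (blind_policies :: ('o::finite, 'a::finite) policy set)"
proof -
  have "blind_policies = (\<Inter>ob ob' a. {\<delta>. \<delta> 0 ob a = \<delta> 0 ob' a}) \<inter>
      (\<Inter>t ob. (\<Inter>a. {\<delta>. 0 \<le> \<delta> t ob a}) \<inter> {\<delta>::('o, 'a) policy. (\<Sum>a\<in>UNIV. \<delta> t ob a) = 1})"
    by (auto simp: blind_policies_def initially_blind_def)
  moreover have "closed \<dots>"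
    by (intro closed_Int closed_INT ballI closed_Collect_eq closed_Collect_le
        continuous_on_sum continuous_on_policy_entry continuous_on_const)
  ultimately show ?thesis by simp
qed

text \<open>Tychonoff's theorem for the function type, whose topology is that of pointwise convergence.\<close>

lemma compact_PiE_UNIV:
  fixes S :: "'i \<Rightarrow> 'x::topological_space set"
  assumes "\<And>i. compact (S i)"
  shows "compact (PiE UNIV S)"
proof -
  have "compactin (product_topology (\<lambda>i::'i. euclidean::'x topology) UNIV) (PiE UNIV S)"
    using assms by (subst compactin_PiE) (intro disjI2 ballI iffD2[OF compactin_euclidean_iff])
  then have "compactin (euclidean :: ('i \<Rightarrow> 'x) topology) (PiE UNIV S)"
    by (subst (asm) euclidean_product_topology)
  then show ?thesis
    by (rule iffD1[OF compactin_euclidean_iff])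
qed

text \<open>A closed subset of a cube.\<close>

lemma compact_blind_policies: "compact (blind_policies :: ('o::finite, 'a::finite) policy set)"
proof -
  define box :: "('o, 'a) policy set"
    where "box = PiE UNIV (\<lambda>t. PiE UNIV (\<lambda>ob. PiE UNIV (\<lambda>a. {0..1})))"
  have "compact box"
    unfolding box_def by (intro compact_PiE_UNIV compact_Icc)
  moreover have "\<delta> \<in> box" if "\<delta> \<in> blind_policies" for \<delta> :: "('o, 'a) policy"
  proof -
    have "\<delta> t ob a \<le> 1" for t ob a
      using that member_le_sum[of a UNIV "\<delta> t ob"] by (auto simp: blind_policies_def)
    then show ?thesis
      using that by (auto simp: box_def blind_policies_def)
  qed
  then have "blind_policies = box \<inter> blind_policies" by blast
  ultimately show ?thesis
    by (metis closed_blind_policies compact_Int_closed)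
qed

text \<open>
  The expected reward is continuous because it is a finite sum of products of entries of the policy. A
  maximiser over the compact set also beats the policies that are arbitrary after the horizon, since those
  can be frozen there without changing their reward.
\<close>

lemma exists_best_blind_policy:
  fixes M :: "('s::finite, 'o::finite, 'a::finite) pomdp"
  obtains \<delta> where "\<delta> \<in> memoryless_policies T" "initially_blind \<delta>"
    and "\<And>\<delta>'. \<delta>' \<in> memoryless_policies T \<Longrightarrow> initially_blind \<delta>' \<Longrightarrow>
      expected_reward M T b \<delta>' \<le> expected_reward M T b \<delta>"
proof -
  have policy: "\<delta> \<in> memoryless_policies T" if "\<delta> \<in> blind_policies" for \<delta> :: "('o, 'a) policy"
    using that by (simp add: blind_policies_def memoryless_policies_def)
  have "continuous_on blind_policies (\<lambda>\<delta>. path_expectation M (Suc T) b \<delta>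
      (\<lambda>\<tau>. \<Sum>t\<le>T. reward M t (state_at t \<tau>) (act_at t \<tau>)))"
    unfolding path_expectation_def path_prob_def step_prob_def
    by (intro continuous_on_sum continuous_on_mult continuous_on_prod continuous_on_const
        continuous_on_policy_entry)
  then have "continuous_on blind_policies (expected_reward M T b)"
    by (simp add: expected_reward_eq_path_expectation policy cong: continuous_on_cong)
  moreover have "(\<lambda>t ob a. if a = undefined then 1 else 0) \<in> (blind_policies :: ('o, 'a) policy set)"
    by (simp add: blind_policies_def initially_blind_def)
  then have "(blind_policies :: ('o, 'a) policy set) \<noteq> {}" by blast
  ultimately obtain \<delta> where \<delta>: "\<delta> \<in> blind_policies"
    "\<And>\<delta>'. \<delta>' \<in> blind_policies \<Longrightarrow> expected_reward M T b \<delta>' \<le> expected_reward M T b \<delta>"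
    using continuous_attains_sup[OF compact_blind_policies, of "expected_reward M T b"] by blast
  show ?thesis
  proof
    show "\<delta> \<in> memoryless_policies T" "initially_blind \<delta>"
      using \<delta>(1) policy by (auto simp: blind_policies_def)
  next
    fix \<delta>' :: "('o, 'a) policy"
    assume "\<delta>' \<in> memoryless_policies T" "initially_blind \<delta>'"
    then have "stationary_after T \<delta>' \<in> blind_policies"
      by (simp add: blind_policies_def memoryless_policies_def initially_blind_def stationary_after_def)
    from \<delta>(2)[OF this] show "expected_reward M T b \<delta>' \<le> expected_reward M T b \<delta>"
      using expected_reward_cong[of T \<delta>' "stationary_after T \<delta>'" M b]
      by (simp add: stationary_after_def)
  qed
qed

section \<open>Equivalence of the two problems\<close>

lemma SUP_eq_arg_max:
  fixes f :: "'x \<Rightarrow> real"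
  assumes "is_arg_max f P x"
  shows "(SUP y\<in>{y. P y}. f y) = f x"
  using assms by (intro cSup_eq_maximum) (auto simp: is_arg_max_linorder)

theorem theorem1:
  fixes M :: "('s::finite, 'o::finite, 'a::finite) pomdp"
    and T :: nat
    and b :: "'s pmf"
  shows "(\<forall>\<mu> \<delta>. nlp_feasible M T b (\<mu>, \<delta>) \<longrightarrow>
            (\<forall>t\<le>Suc T. \<forall>s.
               mu_s \<mu> t s = \<P>(\<tau> in trajectory_measure M T b \<delta>. state_at t \<tau> = s)) \<and>
            (\<forall>t\<le>T. \<forall>s ob a.
               mu_soa \<mu> t s ob a = \<P>(\<tau> in trajectory_measure M T b \<delta>.
                  state_at t \<tau> = s \<and> obs_at t \<tau> = ob \<and> act_at t \<tau> = a)) \<and>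
            (\<forall>t\<le>T. \<forall>s a.
               mu_sa \<mu> t s a = \<P>(\<tau> in trajectory_measure M T b \<delta>.
                  state_at t \<tau> = s \<and> act_at t \<tau> = a)) \<and>
            (is_arg_max (nlp_objective M T) (nlp_feasible M T b) (\<mu>, \<delta>) \<longleftrightarrow>
               optimal_memoryless_policy M T b \<delta>)) \<and>
         (\<exists>x. is_arg_max (memoryless_objective M T b) (memoryless_feasible T) x) \<and>
         (\<exists>y. is_arg_max (nlp_objective M T) (nlp_feasible M T b) y) \<and>
         w_ml M T b = z_ml M T b"
proof -
  let ?V = "expected_reward M T b"
  obtain best where best: "best \<in> memoryless_policies T" "initially_blind best"
    and upper: "\<And>\<delta>. \<delta> \<in> memoryless_policies T \<Longrightarrow> initially_blind \<delta> \<Longrightarrow> ?V \<delta> \<le> ?V best"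
    using exists_best_blind_policy[of T M b] by blast
  \<comment> \<open>Some forced initial action keeps the best value, and it cannot improve on it since a forced
    action is itself blind.\<close>
  obtain a where "?V best \<le> ?V (force_initial_action a best)"
    using exists_forced_action_at_least[OF best] by blast
  then have forced: "?V (force_initial_action a best) = ?V best"
    by (intro antisym upper force_initial_action_policy best initially_blind_force)
  have feasible: "\<delta> \<in> memoryless_policies T" "initially_blind \<delta>"
    if "nlp_feasible M T b (\<mu>, \<delta>)" for \<mu> \<delta>
    using nlp_feasibleD(1,2)[OF that] by blast+

  have ml_max: "is_arg_max (memoryless_objective M T b) (memoryless_feasible T) (a, best)"
    by (auto simp: is_arg_max_linorder memoryless_feasible_def memoryless_objective_def best forced
        intro!: upper force_initial_action_policy initially_blind_force)
  have nlp_max_iff: "is_arg_max (nlp_objective M T) (nlp_feasible M T b) (\<mu>, \<delta>) \<longleftrightarrow> ?V \<delta> = ?V best"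
    if "nlp_feasible M T b (\<mu>, \<delta>)" for \<mu> \<delta>
  proof
    assume "is_arg_max (nlp_objective M T) (nlp_feasible M T b) (\<mu>, \<delta>)"
    then have "?V best \<le> ?V \<delta>"
      using nlp_feasible_moments_of[OF best] that
      by (metis is_arg_max_linorder nlp_objective_feasible)
    then show "?V \<delta> = ?V best"
      using upper[OF feasible[OF that]] by simp
  next
    assume "?V \<delta> = ?V best"
    then show "is_arg_max (nlp_objective M T) (nlp_feasible M T b) (\<mu>, \<delta>)"
      using that upper[OF feasible]
      by (auto simp: is_arg_max_linorder nlp_objective_feasible)
  qed
  have nlp_max: "is_arg_max (nlp_objective M T) (nlp_feasible M T b) (moments_of M b best, best)"
    using nlp_max_iff[OF nlp_feasible_moments_of[OF best]] by simp

  have w: "w_ml M T b = ?V best"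
    unfolding w_ml_def SUP_eq_arg_max[OF ml_max] by (simp add: memoryless_objective_def forced)
  have z: "z_ml M T b = ?V best"
    unfolding z_ml_def SUP_eq_arg_max[OF nlp_max]
    by (rule nlp_objective_feasible[OF nlp_feasible_moments_of[OF best]])

  have "is_arg_max (nlp_objective M T) (nlp_feasible M T b) (\<mu>, \<delta>) \<longleftrightarrow>
      optimal_memoryless_policy M T b \<delta>" if "nlp_feasible M T b (\<mu>, \<delta>)" for \<mu> \<delta>
    using feasible[OF that] by (simp add: nlp_max_iff[OF that] optimal_memoryless_policy_def w)
  then show ?thesis
    using ml_max nlp_max w z
    by (auto simp: nlp_feasible_mu_s nlp_feasible_mu_soa nlp_feasible_mu_sa
        prob_state prob_state_obs_act prob_state_act dest: feasible)
qed

end
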